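(* Let $A$ be an algorithm for the up-down run generation problem (buffer size $M$) with output $S$ on input $I$. Partition $S$ into $k$ contiguous subsequences $S=S_1\circ S_2\circ\cdots\circ S_k$, and let $x_i$ be the number of runs in $S_i$. Let $I_1=I$, for $1<i\le k$ let $I_i$ be the unwritten-element sequence of $A$ after it has output $S_1\circ\cdots\circ S_{i-1}$, and let $I_{k+1}=\emptyset$. For each $i$, let $S_i'$ be the output of an optimal algorithm on $I_i$. Let $\alpha,\beta\ge 1$, and suppose that for every $i\le k$, $S_i$ covers the first $y_i$ runs of $S_i'$. If $x_i/y_i\le\beta$ for all $i\le k$, then $R(S)\le\beta\,\mathrm{OPT}(I)$. Similarly, if $A$ is randomized and $\mathbb{E}[x_i]/y_i\le\alpha$ for all $i\le k$, then $\mathbb{E}[R(S)]\le\alpha\,\mathrm{OPT}(I)$.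
   Context: Up-down run generation problem: an input stream $I$ of $N$ elements from a totally ordered set is presented in order to an algorithm with a buffer of $M$ slots. The algorithm reads elements one by one from $I$ into the buffer and writes elements from the buffer, appending them to an output sequence $S$; each written element frees its slot, which is filled by the next input element. A run is a sorted or reverse-sorted sequence. $R(S)$ is the smallest $k$ such that $S$ is a concatenation of $k$ runs. $\mathrm{OPT}(I)$ is the minimum of $R(S)$ over all possible outputs of algorithms with buffer size $M$ on $I$; an optimal algorithm on $I$ is one achieving it. At any time, an algorithm's unwritten-element sequence is the contents of its buffer (in order of arrival in $I$) concatenated with the not-yet-read remainder of the input. A sequence $A$ covers a sequence $B$ if every element of $B$ occurs in $A$. *)

theory Defs
  imports "HOL-Probability.Probability" "HOL-Library.Multiset"
begin

section \<open>Runs\<close>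

definition is_run :: "'a::linorder list \<Rightarrow> bool" where
  "is_run xs \<longleftrightarrow> sorted xs \<or> sorted (rev xs)"

definition run_decomposition :: "'a::linorder list list \<Rightarrow> 'a list \<Rightarrow> bool" where
  "run_decomposition rs S \<longleftrightarrow> concat rs = S \<and> (\<forall>r\<in>set rs. is_run r)"

definition num_runs :: "'a::linorder list \<Rightarrow> nat" where
  "num_runs S = (LEAST k. \<exists>rs. run_decomposition rs S \<and> length rs = k)"

section \<open>Buffered algorithms\<close>

text \<open>A state consists of the buffer, listed in order of arrival, and the unread input.
  Equal elements are indistinguishable, so that writing \<open>x\<close> may be taken to remove the copy
  of \<open>x\<close> that arrived first.\<close>

type_synonym 'a state = "'a list \<times> 'a list"

definition initial_state :: "nat \<Rightarrow> 'a list \<Rightarrow> 'a state" where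
  "initial_state M I = (take M I, drop M I)"

fun write_elem :: "'a \<Rightarrow> 'a state \<Rightarrow> 'a state" where
  "write_elem x (buf, inp) = (remove1 x buf @ take 1 inp, drop 1 inp)"

fun writable :: "'a state \<Rightarrow> 'a list \<Rightarrow> bool" where
  "writable st [] \<longleftrightarrow> True"
| "writable st (x # xs) \<longleftrightarrow> x \<in> set (fst st) \<and> writable (write_elem x st) xs"

definition unwritten :: "nat \<Rightarrow> 'a list \<Rightarrow> 'a list \<Rightarrow> 'a list" where
  "unwritten M I T = (case fold write_elem T (initial_state M I) of (buf, inp) \<Rightarrow> buf @ inp)"

definition possible_output :: "nat \<Rightarrow> 'a list \<Rightarrow> 'a list \<Rightarrow> bool" where
  "possible_output M I S \<longleftrightarrow> writable (initial_state M I) S \<and> unwritten M I S = []"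

text \<open>An algorithm is given by its input-output behaviour. It need not be online: the next
  element written may depend on input that has not been read yet.\<close>

definition algorithm :: "nat \<Rightarrow> ('a list \<Rightarrow> 'a list) \<Rightarrow> bool" where
  "algorithm M A \<longleftrightarrow> (\<forall>I. possible_output M I (A I))"

definition OPT :: "nat \<Rightarrow> 'a::linorder list \<Rightarrow> nat" where
  "OPT M I = (LEAST r. \<exists>A. algorithm M A \<and> num_runs (A I) = r)"

definition optimal_algorithm_on ::
    "nat \<Rightarrow> 'a::linorder list \<Rightarrow> ('a list \<Rightarrow> 'a list) \<Rightarrow> bool" where
  "optimal_algorithm_on M I A \<longleftrightarrow> algorithm M A \<and> num_runs (A I) = OPT M I"

text \<open>A randomized algorithm is a random choice \<open>A \<omega>\<close> of a deterministic one.\<close>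

definition randomized_algorithm ::
    "nat \<Rightarrow> 'w measure \<Rightarrow> ('w \<Rightarrow> 'a list \<Rightarrow> 'a list) \<Rightarrow> bool" where
  "randomized_algorithm M P A \<longleftrightarrow>
     prob_space P \<and> (\<forall>\<omega>\<in>space P. algorithm M (A \<omega>)) \<and>
     (\<forall>I. (\<lambda>\<omega>. A \<omega> I) \<in> measurable P (count_space UNIV))"

section \<open>Partitioned outputs\<close>

text \<open>The occurrences of an element in the input are different elements of the stream, so that
  repeated elements have to be covered with their multiplicity. On sequences without
  repetitions this is inclusion of the sets of elements.\<close>

definition covers :: "'a list \<Rightarrow> 'a list \<Rightarrow> bool" where
  "covers A B \<longleftrightarrow> mset B \<subseteq># mset A"

text \<open>A sequence can have several decompositions into the minimal number of runs; any of them
  may provide the first \<open>y\<close> runs.\<close>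

definition covers_first_runs :: "'a::linorder list \<Rightarrow> nat \<Rightarrow> 'a list \<Rightarrow> bool" where
  "covers_first_runs T y S' \<longleftrightarrow>
     (\<exists>rs. run_decomposition rs S' \<and> length rs = num_runs S' \<and> y \<le> length rs \<and>
           covers T (concat (take y rs)))"

text \<open>Parts are indexed from \<open>0\<close>. The unwritten elements before part \<open>i\<close> are those remaining
  once the parts \<open>0, \<dots>, i - 1\<close> have been written.\<close>

definition unwritten_before :: "nat \<Rightarrow> 'a list \<Rightarrow> 'a list list \<Rightarrow> nat \<Rightarrow> 'a list" where
  "unwritten_before M I Ss i = unwritten M I (concat (take i Ss))"

text \<open>The value \<open>0\<close> for missing parts makes this total when the number of parts is random.\<close>

definition part_runs :: "'a::linorder list list \<Rightarrow> nat \<Rightarrow> nat" where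
  "part_runs Ss i = (if i < length Ss then num_runs (Ss ! i) else 0)"

section \<open>Consistency of the definitions\<close>

lemma unwritten_before_0: "unwritten_before M I Ss 0 = I"
  by (simp add: unwritten_before_def unwritten_def initial_state_def)

lemma unwritten_before_length:
  "algorithm M A \<Longrightarrow> concat Ss = A I \<Longrightarrow> unwritten_before M I Ss (length Ss) = []"
  by (simp add: unwritten_before_def algorithm_def possible_output_def)

lemma writable_in_order:
  assumes "inp \<noteq> [] \<longrightarrow> buf \<noteq> []"
  shows "writable (buf, inp) (buf @ inp) \<and> fold write_elem (buf @ inp) (buf, inp) = ([], [])"
  using assms
proof (induction "buf @ inp" arbitrary: buf inp)
  case Nil
  then show ?case by simp
next
  case (Cons x xs)
  then obtain b where b: "buf = x # b" by (cases buf) auto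
  have "xs = (b @ take 1 inp) @ drop 1 inp" using Cons.hyps(2) b by simp
  moreover have "drop 1 inp \<noteq> [] \<longrightarrow> b @ take 1 inp \<noteq> []" by (cases inp) auto
  ultimately show ?case
    using Cons.hyps(1)[of "b @ take 1 inp" "drop 1 inp"] b by simp
qed

lemma algorithm_in_order:
  assumes "M > 0"
  shows "algorithm M (\<lambda>I. I)"
proof -
  have "drop M I \<noteq> [] \<longrightarrow> take M I \<noteq> []" for I :: "'a list"
    using assms by (cases I) auto
  from writable_in_order[OF this] show ?thesis
    by (simp add: algorithm_def possible_output_def unwritten_def initial_state_def)
qed

lemma optimal_algorithm_exists:
  assumes "M > 0"
  shows "\<exists>A. optimal_algorithm_on M I A"
  unfolding optimal_algorithm_on_def OPT_def
  by (rule LeastI_ex) (use algorithm_in_order[OF assms] in blast)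

end

theory Submission
  imports Defs
begin

text \<open>
  If an algorithm has written \<open>T\<close>, deleting from an optimal output on the original input the
  first occurrence of every element of \<open>T\<close> leaves an output that is feasible for the unwritten
  elements: writing an element earlier than planned only lets the buffer fill up earlier. If \<open>T\<close>
  covers the first \<open>y\<close> runs of that output, only the remaining runs survive, so \<open>OPT\<close> drops by at
  least \<open>y\<close>. Summing over the parts gives \<open>\<Sum>i. y\<^sub>i \<le> OPT(I)\<close>, and \<open>R(S) \<le> \<Sum>i. x\<^sub>i\<close>.
  In the randomized case both the number of parts and the \<open>y\<^sub>i\<close> may be random, but the
  expectations of the \<open>x\<^sub>i\<close> are constants: it suffices to sum the bounds on them along a single
  outcome with the largest number of parts that has positive probability.
\<close>

section \<open>The number of runs\<close>

lemma sorted_wrt_remove1: "sorted_wrt R xs \<Longrightarrow> sorted_wrt R (remove1 x xs)"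
  by (induction xs) (auto dest: notin_set_remove1)

lemma is_run_remove1: "is_run xs \<Longrightarrow> is_run (remove1 x xs)"
  unfolding is_run_def sorted_wrt_rev by (blast intro: sorted_wrt_remove1)

text \<open>Ensures that the minimum in \<open>num_runs\<close> is attained, and bounds it by the
  length of \<open>S\<close>.\<close>

lemma run_decomposition_singletons: "run_decomposition (map (\<lambda>x. [x]) S) S"
  by (auto simp: run_decomposition_def is_run_def)

lemma num_runs_le: "run_decomposition rs S \<Longrightarrow> num_runs S \<le> length rs"
  unfolding num_runs_def by (rule Least_le) blast

lemma num_runs_decomposition:
  obtains rs where "run_decomposition rs S" "length rs = num_runs S"
proof -
  have "\<exists>k rs. run_decomposition rs S \<and> length rs = k"
    using run_decomposition_singletons by blast
  from LeastI_ex[OF this] show ?thesis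
    using that unfolding num_runs_def by blast
qed

lemma num_runs_le_length: "num_runs S \<le> length S"
  using num_runs_le[OF run_decomposition_singletons[of S]] by simp

lemma num_runs_append: "num_runs (xs @ ys) \<le> num_runs xs + num_runs ys"
proof -
  obtain rs where rs: "run_decomposition rs xs" "length rs = num_runs xs"
    by (rule num_runs_decomposition)
  obtain qs where qs: "run_decomposition qs ys" "length qs = num_runs ys"
    by (rule num_runs_decomposition)
  have "run_decomposition (rs @ qs) (xs @ ys)"
    using rs(1) qs(1) by (auto simp: run_decomposition_def)
  from num_runs_le[OF this] show ?thesis
    using rs(2) qs(2) by simp
qed

lemma num_runs_concat: "num_runs (concat Ss) \<le> (\<Sum>i<length Ss. num_runs (Ss ! i))"
proof (induction Ss)
  case Nil
  then show ?case using num_runs_le_length[of "[]"] by simp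
next
  case (Cons S Ss)
  then show ?case
    using num_runs_append[of S "concat Ss"]
    by (simp add: sum.lessThan_Suc_shift del: sum.lessThan_Suc)
qed

text \<open>The first occurrence of \<open>x\<close> lies in a single run, which stays monotone
  without it. Empty runs are allowed, so the number of runs can be kept.\<close>

lemma run_decomposition_remove1:
  "run_decomposition rs S \<Longrightarrow> \<exists>rs'. run_decomposition rs' (remove1 x S) \<and> length rs' = length rs"
proof (induction rs arbitrary: S)
  case Nil
  then show ?case by (simp add: run_decomposition_def)
next
  case (Cons r rs)
  then have S: "S = r @ concat rs" and r: "is_run r" and rs: "run_decomposition rs (concat rs)"
    by (auto simp: run_decomposition_def)
  show ?case
  proof (cases "x \<in> set r")
    case True
    then have "run_decomposition (remove1 x r # rs) (remove1 x S)"
      using r rs by (auto simp: S run_decomposition_def remove1_append is_run_remove1)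
    then show ?thesis by (metis length_Cons)
  next
    case False
    obtain rs' where "run_decomposition rs' (remove1 x (concat rs))" "length rs' = length rs"
      using Cons.IH[OF rs] by blast
    then have "run_decomposition (r # rs') (remove1 x S)" "length (r # rs') = length (r # rs)"
      using False r by (auto simp: S run_decomposition_def remove1_append)
    then show ?thesis by blast
  qed
qed

lemma num_runs_remove1: "num_runs (remove1 x S) \<le> num_runs S"
  by (metis num_runs_decomposition num_runs_le run_decomposition_remove1)

text \<open>Each deletion takes a first occurrence, so it hits the prefix \<open>U\<close> as long
  as \<open>U\<close> still contains the element. As \<open>T\<close> contains \<open>U\<close> with
  multiplicities, \<open>U\<close> gets used up; the other deletions can only affect
  \<open>V\<close> and never increase its number of runs.\<close>

lemma num_runs_fold_remove1_append:
  assumes "mset U \<subseteq># mset T"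
  shows "num_runs (fold remove1 T (U @ V)) \<le> num_runs V"
  using assms
proof (induction T arbitrary: U V)
  case Nil
  then show ?case by simp
next
  case (Cons x T)
  show ?case
  proof (cases "x \<in> set U")
    case True
    then have "mset (remove1 x U) \<subseteq># mset T"
      using Cons.prems by (simp add: subset_eq_diff_conv)
    from Cons.IH[OF this, of V] show ?thesis
      using True by (simp add: remove1_append)
  next
    case False
    then have "mset U \<subseteq># mset T"
      using Cons.prems subset_eq_diff_conv[of "mset U" "{#x#}" "mset T"]
        diff_single_trivial[of x "mset U"] by simp
    from Cons.IH[OF this, of "remove1 x V"] show ?thesis
      using False num_runs_remove1[of x V] by (simp add: remove1_append)
  qed
qed

section \<open>Feasible outputs\<close>

lemma writable_append:
  "writable st (xs @ ys) \<longleftrightarrow> writable st xs \<and> writable (fold write_elem xs st) ys"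
  by (induction xs arbitrary: st) auto

text \<open>Both elements are already in the buffer, so neither removal can touch an element
  arriving in between, and the arrivals come in the same order either way.\<close>

lemma write_elem_commute:
  assumes "x \<in> set (fst st)" "z \<in> set (fst st)" "x \<noteq> z"
  shows "write_elem x (write_elem z st) = write_elem z (write_elem x st)"
  using assms by (cases st) (simp add: remove1_append in_set_remove1 remove1_commute)

lemma in_buffer_write_elem: "x \<in> set (fst st) \<Longrightarrow> x \<noteq> z \<Longrightarrow> x \<in> set (fst (write_elem z st))"
  by (cases st) (simp add: in_set_remove1)

text \<open>Exchange argument: the plan \<open>S\<close> empties the buffer, so it writes
  \<open>x\<close> eventually. If \<open>x\<close> is written at once, all writes planned before it
  stay possible, and by commutation both schedules are in the same state once \<open>S\<close> has
  written \<open>x\<close>.\<close>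

lemma feasible_remove1:
  assumes "writable st S" "fold write_elem S st = ([], [])" "x \<in> set (fst st)"
  shows "writable (write_elem x st) (remove1 x S) \<and>
         fold write_elem (remove1 x S) (write_elem x st) = ([], [])"
  using assms
proof (induction S arbitrary: st)
  case Nil
  then show ?case by simp
next
  case (Cons z S)
  show ?case
  proof (cases "z = x")
    case True
    then show ?thesis using Cons.prems by simp
  next
    case False
    then show ?thesis
      using Cons.prems Cons.IH[of "write_elem z st"] write_elem_commute[of x st z]
      by (simp add: in_buffer_write_elem)
  qed
qed

lemma feasible_fold_remove1:
  assumes "writable st S" "fold write_elem S st = ([], [])" "writable st T"
  shows "writable (fold write_elem T st) (fold remove1 T S) \<and>
         fold write_elem (fold remove1 T S) (fold write_elem T st) = ([], [])"
  using assms
proof (induction T arbitrary: st S)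
  case Nil
  then show ?case by simp
next
  case (Cons x T)
  then show ?case using feasible_remove1[of st S x] by simp
qed

section \<open>Output length and restarting from a reached state\<close>

lemma feasible_length:
  assumes "writable (buf, inp) S" "fold write_elem S (buf, inp) = ([], [])"
  shows "length S = length buf + length inp"
  using assms
proof (induction S arbitrary: buf inp)
  case Nil
  then show ?case by simp
next
  case (Cons x S)
  then have "length S = length (remove1 x buf @ take 1 inp) + length (drop 1 inp)"
    using Cons.IH[of "remove1 x buf @ take 1 inp" "drop 1 inp"]
    by (simp del: length_append length_drop)
  then show ?case
    using Cons.prems(1) length_pos_if_in_set[of x buf]
    by (cases inp) (auto simp: length_remove1)
qed

lemma possible_output_iff:
  "possible_output M I S \<longleftrightarrow>
     writable (initial_state M I) S \<and> fold write_elem S (initial_state M I) = ([], [])"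
  by (auto simp: possible_output_def unwritten_def split: prod.splits)

text \<open>Serves to bound the run counts of all outputs on \<open>I\<close> by one constant, which
  makes them integrable.\<close>

lemma possible_output_length: "possible_output M I S \<Longrightarrow> length S = length I"
  using feasible_length[of "take M I" "drop M I" S]
  by (simp add: possible_output_iff initial_state_def)

text \<open>The condition says that the buffer is never left partially empty while input remains.\<close>

lemma initial_state_fold_write_elem:
  assumes "length buf = M \<or> length buf \<le> M \<and> inp = []" "writable (buf, inp) T"
    and "fold write_elem T (buf, inp) = (buf', inp')"
  shows "initial_state M (buf' @ inp') = (buf', inp')"
  using assms
proof (induction T arbitrary: buf inp)
  case Nil
  then show ?case by (auto simp: initial_state_def)
next
  case (Cons x T)
  let ?buf = "remove1 x buf @ take 1 inp"
  have "x \<in> set buf" using Cons.prems(2) by simp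
  then have "length ?buf = M \<or> length ?buf \<le> M \<and> drop 1 inp = []"
    using Cons.prems(1) length_pos_if_in_set[of x buf]
    by (cases inp) (auto simp: length_remove1)
  from Cons.IH[OF this] show ?case using Cons.prems(2,3) by simp
qed

text \<open>Allows a restart: continuing after \<open>T\<close> is the same as starting afresh on
  the unwritten elements, so their \<open>OPT\<close> can be compared with continuations after
  \<open>T\<close>.\<close>

lemma initial_state_unwritten:
  assumes "writable (initial_state M I) T"
  shows "initial_state M (unwritten M I T) = fold write_elem T (initial_state M I)"
proof -
  obtain b i where bi: "fold write_elem T (initial_state M I) = (b, i)" by fastforce
  have "length (take M I) = M \<or> length (take M I) \<le> M \<and> drop M I = []" by auto
  from initial_state_fold_write_elem[OF this] show ?thesis
    using assms bi by (simp add: unwritten_def initial_state_def)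
qed

lemma unwritten_append:
  assumes "writable (initial_state M I) T"
  shows "unwritten M (unwritten M I T) T' = unwritten M I (T @ T')"
  using initial_state_unwritten[OF assms]
  by (simp add: unwritten_def[of M _ T'] unwritten_def[of M I "T @ T'"])

section \<open>Decrease of \<open>OPT\<close> along the parts\<close>

lemma OPT_le:
  assumes "M > 0" "possible_output M I S"
  shows "OPT M I \<le> num_runs S"
proof -
  \<comment> \<open>\<open>OPT\<close> ranges over algorithms that are correct on every input, so
    the single output \<open>S\<close> is extended by writing every other input in order, which
    needs only one buffer slot.\<close>
  have "algorithm M ((\<lambda>J. J)(I := S))"
    using assms algorithm_in_order[OF assms(1)] by (auto simp: algorithm_def)
  then show ?thesis
    unfolding OPT_def by (intro Least_le) (metis fun_upd_same)
qed

lemma OPT_unwritten: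
  assumes "M > 0" "writable (initial_state M I) T" "optimal_algorithm_on M I A'"
    and "covers_first_runs T y (A' I)"
  shows "y + OPT M (unwritten M I T) \<le> OPT M I"
proof -
  obtain rs where rs: "run_decomposition rs (A' I)" "length rs = num_runs (A' I)"
      "y \<le> length rs" and cov: "mset (concat (take y rs)) \<subseteq># mset T"
    using assms(4) by (auto simp: covers_first_runs_def covers_def)
  have A': "algorithm M A'" "num_runs (A' I) = OPT M I"
    using assms(3) by (auto simp: optimal_algorithm_on_def)
  let ?V = "concat (drop y rs)"
  have split: "A' I = concat (take y rs) @ ?V"
    using rs(1) by (simp add: run_decomposition_def flip: concat_append)
  have "run_decomposition (drop y rs) ?V"
    using rs(1) by (auto simp: run_decomposition_def dest: in_set_dropD)
  from num_runs_le[OF this] have V: "num_runs ?V \<le> OPT M I - y"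
    using rs(2) A'(2) by simp
  have "possible_output M (unwritten M I T) (fold remove1 T (A' I))"
    using feasible_fold_remove1[OF _ _ assms(2), of "A' I"] A'(1)
    by (simp add: algorithm_def possible_output_iff initial_state_unwritten[OF assms(2)])
  from OPT_le[OF assms(1) this] have "OPT M (unwritten M I T) \<le> OPT M I - y"
    using num_runs_fold_remove1_append[OF cov, of ?V] V split by simp
  \<comment> \<open>The subtraction is exact, since \<open>y\<close> is at most the number of runs
    of \<open>A' I\<close>, which is \<open>OPT M I\<close>.\<close>
  then show ?thesis using rs(2,3) A'(2) by linarith
qed

lemma sum_covered_runs_le_OPT:
  assumes "M > 0" "writable (initial_state M I) (concat Ss)"
    and "\<And>i. i < length Ss \<Longrightarrow>
           optimal_algorithm_on M (unwritten_before M I Ss i) (A' i) \<and>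
           covers_first_runs (Ss ! i) (y i) (A' i (unwritten_before M I Ss i))"
  shows "(\<Sum>i<length Ss. y i) \<le> OPT M I"
proof -
  \<comment> \<open>Keeping the \<open>OPT\<close> of the unwritten elements on the left makes the
    bounds for single parts telescope; it is dropped at the end.\<close>
  have "(\<Sum>i<k. y i) + OPT M (unwritten_before M I Ss k) \<le> OPT M I" if "k \<le> length Ss" for k
    using that
  proof (induction k)
    case 0
    then show ?case by (simp add: unwritten_before_0)
  next
    case (Suc k)
    let ?T = "concat (take k Ss)" and ?J = "unwritten_before M I Ss k"
    have take: "take (Suc k) Ss = take k Ss @ [Ss ! k]"
      using Suc.prems by (simp add: take_Suc_conv_app_nth)
    have "concat Ss = (?T @ Ss ! k) @ concat (drop (Suc k) Ss)"
      using append_take_drop_id[of "Suc k" Ss] take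
      by (metis append.assoc append.right_neutral concat.simps(1,2) concat_append)
    then have w: "writable (initial_state M I) ?T"
        "writable (fold write_elem ?T (initial_state M I)) (Ss ! k)"
      using assms(2) by (simp_all add: writable_append)
    \<comment> \<open>By the restart property, \<open>?J\<close> can be treated as a new input whose
      output begins with part \<open>k\<close>.\<close>
    have "writable (initial_state M ?J) (Ss ! k)"
      using w by (simp add: unwritten_before_def initial_state_unwritten)
    then have "y k + OPT M (unwritten M ?J (Ss ! k)) \<le> OPT M ?J"
      using OPT_unwritten[OF assms(1)] assms(3)[of k] Suc.prems by auto
    moreover have "unwritten M ?J (Ss ! k) = unwritten_before M I Ss (Suc k)"
      using unwritten_append[OF w(1)] by (simp add: unwritten_before_def take)
    ultimately show ?case using Suc by simp
  qed
  from this[of "length Ss"] show ?thesis by simp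
qed

section \<open>The expected number of runs\<close>

text \<open>Missing parts contribute 0, so the sum may run up to a bound \<open>K\<close> that does
  not depend on the outcome.\<close>

lemma num_runs_concat_part_runs:
  assumes "length Ss \<le> K"
  shows "num_runs (concat Ss) \<le> (\<Sum>i<K. part_runs Ss i)"
proof -
  have "(\<Sum>i<length Ss. num_runs (Ss ! i)) = (\<Sum>i<length Ss. part_runs Ss i)"
    by (simp add: part_runs_def)
  also have "\<dots> \<le> (\<Sum>i<K. part_runs Ss i)"
    using assms by (intro sum_mono2) auto
  finally show ?thesis using num_runs_concat[of Ss] by simp
qed

lemma part_runs_le_length_concat: "part_runs Ss i \<le> length (concat Ss)"
proof (cases "i < length Ss")
  case True
  then have "length (Ss ! i) \<le> length (concat Ss)"
    by (simp add: length_concat member_le_sum_list)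
  then show ?thesis
    using True num_runs_le_length[of "Ss ! i"] by (simp add: part_runs_def)
qed (simp add: part_runs_def)

lemma expected_num_runs_le:
  fixes P :: "'w measure" and Ss :: "'w \<Rightarrow> 'a::linorder list list"
  assumes "prob_space P" and meas: "Ss \<in> measurable P (count_space UNIV)" and "c \<ge> 0"
    and len: "AE \<omega> in P. length (concat (Ss \<omega>)) \<le> n"
    and bounds: "AE \<omega> in P. (\<Sum>i<length (Ss \<omega>). y \<omega> i) \<le> N \<and>
          (\<forall>i<length (Ss \<omega>). 0 < y \<omega> i \<and>
             (\<integral>\<omega>'. real (part_runs (Ss \<omega>') i) \<partial>P) / real (y \<omega> i) \<le> c)"
  shows "(\<integral>\<omega>. real (num_runs (concat (Ss \<omega>))) \<partial>P) \<le> c * real N"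
proof -
  interpret prob_space P by fact
  let ?E = "\<lambda>i. \<integral>\<omega>. real (part_runs (Ss \<omega>) i) \<partial>P"
  have int: "integrable P (\<lambda>\<omega>. real (part_runs (Ss \<omega>) i))" for i
  proof (rule integrable_const_bound[where B = "real n"])
    show "AE \<omega> in P. norm (real (part_runs (Ss \<omega>) i)) \<le> real n"
      using len by eventually_elim (use part_runs_le_length_concat order_trans in fastforce)
    show "(\<lambda>\<omega>. real (part_runs (Ss \<omega>) i)) \<in> borel_measurable P"
      by (rule measurable_compose[OF meas]) simp
  qed
  \<comment> \<open>Each \<open>y \<omega> i\<close> is at least 1, so the bound on their sum also
    bounds the number of parts.\<close>
  have "AE \<omega> in P. length (Ss \<omega>) \<le> N"
    using bounds
  proof eventually_elim
    case (elim \<omega>)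
    have "(\<Sum>i<length (Ss \<omega>). 1) \<le> (\<Sum>i<length (Ss \<omega>). y \<omega> i)"
      using elim by (intro sum_mono) (simp add: Suc_le_eq)
    then show ?case using elim by simp
  qed
  then have ex: "\<exists>K. AE \<omega> in P. length (Ss \<omega>) \<le> K" by blast
  \<comment> \<open>\<open>K\<close> is the essential supremum of the number of parts.\<close>
  define K where "K = (LEAST K. AE \<omega> in P. length (Ss \<omega>) \<le> K)"
  have K: "AE \<omega> in P. length (Ss \<omega>) \<le> K"
    unfolding K_def by (rule LeastI_ex[OF ex])
  obtain \<omega> where \<omega>: "length (Ss \<omega>) = K" "(\<Sum>i<K. y \<omega> i) \<le> N"
      "\<And>i. i < K \<Longrightarrow> 0 < y \<omega> i \<and> ?E i / real (y \<omega> i) \<le> c"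
  proof -
    have "\<exists>\<omega>. length (Ss \<omega>) = K \<and> (\<Sum>i<length (Ss \<omega>). y \<omega> i) \<le> N \<and>
          (\<forall>i<length (Ss \<omega>). 0 < y \<omega> i \<and> ?E i / real (y \<omega> i) \<le> c)"
    \<comment> \<open>Otherwise there would almost surely be fewer than \<open>K\<close> parts,
      against the minimality of \<open>K\<close>, or, if \<open>K = 0\<close>, against
      \<open>P\<close> being a probability measure.\<close>
    proof (rule ccontr)
      assume no: "\<not> ?thesis"
      have less: "AE \<omega> in P. length (Ss \<omega>) < K"
        using K bounds by eventually_elim (use no le_neq_implies_less in blast)
      show False
      proof (cases K)
        case 0
        then show False using less by (simp add: AE_False)
      next
        case (Suc K')
        then have "K \<le> K'"
          using less unfolding K_def by (intro Least_le) (simp add: K_def less_Suc_eq_le)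
        then show False using Suc by simp
      qed
    qed
    then show ?thesis using that by blast
  qed
  have "(\<integral>\<omega>. real (num_runs (concat (Ss \<omega>))) \<partial>P) \<le> (\<integral>\<omega>. (\<Sum>i<K. real (part_runs (Ss \<omega>) i)) \<partial>P)"
  proof (rule integral_mono_AE')
    show "AE \<omega> in P. real (num_runs (concat (Ss \<omega>))) \<le> (\<Sum>i<K. real (part_runs (Ss \<omega>) i))"
      using K
      by eventually_elim (use num_runs_concat_part_runs in \<open>simp flip: of_nat_sum\<close>)
  qed (auto intro!: int AE_I2 sum_nonneg)
  also have "\<dots> = (\<Sum>i<K. ?E i)"
    by (intro Bochner_Integration.integral_sum int)
  \<comment> \<open>The expectations do not depend on the outcome, and the chosen one has all
    \<open>K\<close> parts, so its ratio bounds cover every summand.\<close>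
  also have "\<dots> \<le> (\<Sum>i<K. c * real (y \<omega> i))"
  proof (rule sum_mono)
    fix i assume "i \<in> {..<K}"
    then show "?E i \<le> c * real (y \<omega> i)"
      using \<omega>(3)[of i] by (auto simp: pos_divide_le_eq)
  qed
  also have "\<dots> = c * real (\<Sum>i<K. y \<omega> i)"
    by (simp add: sum_distrib_left)
  also have "\<dots> \<le> c * real N"
    using \<omega>(2) \<open>c \<ge> 0\<close> by (intro mult_left_mono of_nat_mono) auto
  finally show ?thesis .
qed

theorem theorem2:
  fixes M :: nat and I :: "'a::linorder list" and \<alpha> \<beta> :: real
  assumes "M > 0" and "\<alpha> \<ge> 1" and "\<beta> \<ge> 1"
  shows
    "(\<forall>(A :: 'a list \<Rightarrow> 'a list) (Ss :: 'a list list)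
        (A' :: nat \<Rightarrow> 'a list \<Rightarrow> 'a list) (y :: nat \<Rightarrow> nat).
        algorithm M A \<longrightarrow>
        concat Ss = A I \<longrightarrow>
        (\<forall>i<length Ss.
           optimal_algorithm_on M (unwritten_before M I Ss i) (A' i) \<and>
           y i > 0 \<and>
           covers_first_runs (Ss ! i) (y i) (A' i (unwritten_before M I Ss i))) \<longrightarrow>
        (\<forall>i<length Ss. real (num_runs (Ss ! i)) / real (y i) \<le> \<beta>) \<longrightarrow>
        real (num_runs (A I)) \<le> \<beta> * real (OPT M I)) \<and>
     (\<forall>(P :: 'w measure) (A :: 'w \<Rightarrow> 'a list \<Rightarrow> 'a list) (Ss :: 'w \<Rightarrow> 'a list list)
        (A' :: 'w \<Rightarrow> nat \<Rightarrow> 'a list \<Rightarrow> 'a list) (y :: 'w \<Rightarrow> nat \<Rightarrow> nat).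
        randomized_algorithm M P A \<longrightarrow>
        Ss \<in> measurable P (count_space UNIV) \<longrightarrow>
        (AE \<omega> in P. concat (Ss \<omega>) = A \<omega> I) \<longrightarrow>
        (AE \<omega> in P. \<forall>i<length (Ss \<omega>).
           optimal_algorithm_on M (unwritten_before M I (Ss \<omega>) i) (A' \<omega> i) \<and>
           y \<omega> i > 0 \<and>
           covers_first_runs (Ss \<omega> ! i) (y \<omega> i) (A' \<omega> i (unwritten_before M I (Ss \<omega>) i))) \<longrightarrow>
        (AE \<omega> in P. \<forall>i<length (Ss \<omega>).
           (\<integral>\<omega>'. real (part_runs (Ss \<omega>') i) \<partial>P) / real (y \<omega> i) \<le> \<alpha>) \<longrightarrow>
        (\<integral>\<omega>. real (num_runs (A \<omega> I)) \<partial>P) \<le> \<alpha> * real (OPT M I))"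
proof (intro conjI allI impI)
  fix A :: "'a list \<Rightarrow> 'a list" and Ss :: "'a list list"
    and A' :: "nat \<Rightarrow> 'a list \<Rightarrow> 'a list" and y :: "nat \<Rightarrow> nat"
  assume A: "algorithm M A" and Ss: "concat Ss = A I"
    and cov: "\<forall>i<length Ss.
           optimal_algorithm_on M (unwritten_before M I Ss i) (A' i) \<and>
           y i > 0 \<and>
           covers_first_runs (Ss ! i) (y i) (A' i (unwritten_before M I Ss i))"
    and ratio: "\<forall>i<length Ss. real (num_runs (Ss ! i)) / real (y i) \<le> \<beta>"
  have "writable (initial_state M I) (concat Ss)"
    using A by (simp add: Ss algorithm_def possible_output_def)
  then have le: "(\<Sum>i<length Ss. y i) \<le> OPT M I"
    by (rule sum_covered_runs_le_OPT[OF assms(1), where A' = A']) (use cov in blast)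
  have "real (num_runs (A I)) \<le> (\<Sum>i<length Ss. real (num_runs (Ss ! i)))"
    using num_runs_concat[of Ss] by (simp add: Ss flip: of_nat_sum)
  also have "\<dots> \<le> (\<Sum>i<length Ss. \<beta> * real (y i))"
    using ratio cov by (intro sum_mono) (simp add: pos_divide_le_eq)
  also have "\<dots> = \<beta> * real (\<Sum>i<length Ss. y i)"
    by (simp add: sum_distrib_left)
  also have "\<dots> \<le> \<beta> * real (OPT M I)"
    using le assms(3) by (intro mult_left_mono of_nat_mono) auto
  finally show "real (num_runs (A I)) \<le> \<beta> * real (OPT M I)" .
next
  fix P :: "'w measure" and A :: "'w \<Rightarrow> 'a list \<Rightarrow> 'a list" and Ss :: "'w \<Rightarrow> 'a list list"
    and A' :: "'w \<Rightarrow> nat \<Rightarrow> 'a list \<Rightarrow> 'a list" and y :: "'w \<Rightarrow> nat \<Rightarrow> nat"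
  assume A: "randomized_algorithm M P A" and meas: "Ss \<in> measurable P (count_space UNIV)"
    and Ss: "AE \<omega> in P. concat (Ss \<omega>) = A \<omega> I"
    and cov: "AE \<omega> in P. \<forall>i<length (Ss \<omega>).
           optimal_algorithm_on M (unwritten_before M I (Ss \<omega>) i) (A' \<omega> i) \<and>
           y \<omega> i > 0 \<and>
           covers_first_runs (Ss \<omega> ! i) (y \<omega> i) (A' \<omega> i (unwritten_before M I (Ss \<omega>) i))"
    and ratio: "AE \<omega> in P. \<forall>i<length (Ss \<omega>).
           (\<integral>\<omega>'. real (part_runs (Ss \<omega>') i) \<partial>P) / real (y \<omega> i) \<le> \<alpha>"
  have "prob_space P" using A by (simp add: randomized_algorithm_def)
  have out: "AE \<omega> in P. possible_output M I (concat (Ss \<omega>))"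
    using Ss AE_space by eventually_elim (use A in \<open>simp add: randomized_algorithm_def algorithm_def\<close>)
  \<comment> \<open>The concatenated parts agree with the output only almost surely, so equality of
    the integrals is derived from measurability of both run counts.\<close>
  have meas': "(\<lambda>\<omega>. real (num_runs (concat (Ss \<omega>)))) \<in> borel_measurable P"
    by (rule measurable_compose[OF meas]) simp
  have "(\<lambda>\<omega>. A \<omega> I) \<in> measurable P (count_space UNIV)"
    using A by (simp add: randomized_algorithm_def)
  then have "(\<lambda>\<omega>. real (num_runs (A \<omega> I))) \<in> borel_measurable P"
    by (rule measurable_compose) simp
  then have "(\<integral>\<omega>. real (num_runs (A \<omega> I)) \<partial>P) = (\<integral>\<omega>. real (num_runs (concat (Ss \<omega>))) \<partial>P)"
    using meas' by (rule integral_cong_AE) (use Ss in \<open>auto elim!: eventually_mono\<close>)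
  also have "\<dots> \<le> \<alpha> * real (OPT M I)"
  proof (rule expected_num_runs_le[OF \<open>prob_space P\<close> meas])
    show "AE \<omega> in P. length (concat (Ss \<omega>)) \<le> length I"
      using out by eventually_elim (simp only: possible_output_length order_refl)
    show "AE \<omega> in P. (\<Sum>i<length (Ss \<omega>). y \<omega> i) \<le> OPT M I \<and>
          (\<forall>i<length (Ss \<omega>). 0 < y \<omega> i \<and>
             (\<integral>\<omega>'. real (part_runs (Ss \<omega>') i) \<partial>P) / real (y \<omega> i) \<le> \<alpha>)"
      using out cov ratio
    proof eventually_elim
      case (elim \<omega>)
      have "(\<Sum>i<length (Ss \<omega>). y \<omega> i) \<le> OPT M I"
        by (rule sum_covered_runs_le_OPT[OF assms(1), where A' = "A' \<omega>"])
          (use elim in \<open>auto simp: possible_output_def\<close>)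
      then show ?case using elim by blast
    qed
  qed (use assms(2) in simp)
  finally show "(\<integral>\<omega>. real (num_runs (A \<omega> I)) \<partial>P) \<le> \<alpha> * real (OPT M I)" .
qed

end
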